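(* Let $f\colon X\to Y$ be a surjective morphism of racks. The kernel $\mathrm{Ker}(\vec f)$ of the induced group homomorphism $\vec f\colon\mathrm{Pth}(X)\to\mathrm{Pth}(Y)$ is the normal subgroup $\mathrm K_{\vec f}$ of $\vec f$-symmetric paths: $$\mathrm{Ker}(\vec f)=\mathrm K_{\vec f}=\langle\langle\, \underline a\,\underline b^{-1}\mid (a,b)\in\mathrm{Eq}(f)\,\rangle\rangle_{\mathrm{Pth}(X)},$$ where $\langle\langle-\rangle\rangle_{\mathrm{Pth}(X)}$ denotes the normal subgroup of $\mathrm{Pth}(X)$ generated by a set.
   Context: A rack is a set $X$ with two binary operations $\triangleleft,\triangleleft^{-1}$ such that $(x\triangleleft y)\triangleleft^{-1}y = x = (x\triangleleft^{-1}y)\triangleleft y$ and $(x\triangleleft y)\triangleleft z=(x\triangleleft z)\triangleleft(y\triangleleft z)$. $\mathrm{Pth}(X)$ is the group with generators $\underline x$ ($x\in X$) and relations $\underline{x\triangleleft a}=\underline a^{-1}\underline x\,\underline a$ ($x,a\in X$). A morphism $f$ induces $\vec f=\mathrm{Pth}(f)$, $\underline x\mapsto\underline{f(x)}$. For a map $f$, $\mathrm{Eq}(f)=\{(a,b)\mid f(a)=f(b)\}$. For a group homomorphism $\phi\colon G\to H$ and a generating set $E\subseteq G$, two elements $g_a,g_b\in G$ are $\phi$-symmetric to each other if there are $n\in\mathbb N$, pairs $(a_1,b_1),\dots,(a_n,b_n)\in(E\times E)\cap\mathrm{Eq}(\phi)$ and $\delta_i\in\{-1,1\}$ such that $g_a=a_1^{\delta_1}\cdots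 a_n^{\delta_n}$ and $g_b=b_1^{\delta_1}\cdots b_n^{\delta_n}$. $\mathrm K_\phi$ is the set of elements $g_ag_b^{-1}$ with $g_a,g_b$ $\phi$-symmetric to each other ($\phi$-symmetric paths). For $\phi=\vec f$ the generating set of $\mathrm{Pth}(X)$ is $\{\underline x\mid x\in X\}$. *)

theory Defs
  imports "HOL-Algebra.Generated_Groups"
begin

section \<open>Groups given by generators and relations\<close>

text \<open>
  A word is a list of letters \<open>(x, e)\<close>, where \<open>(x, True)\<close> stands for the generator \<open>x\<close> and
  \<open>(x, False)\<close> for its formal inverse. A set of relations is a set of pairs of words \<open>(u, v)\<close>,
  each read as \<open>u = v\<close>.
\<close>

type_synonym 'a word = "('a \<times> bool) list"

abbreviation words :: "'a set \<Rightarrow> 'a word set" where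
  "words S \<equiv> lists (S \<times> UNIV)"

inductive_set presented_cong :: "'a set \<Rightarrow> ('a word \<times> 'a word) set \<Rightarrow> ('a word \<times> 'a word) set"
  for S R where
  refl: "w \<in> words S \<Longrightarrow> (w, w) \<in> presented_cong S R"
| sym: "(u, v) \<in> presented_cong S R \<Longrightarrow> (v, u) \<in> presented_cong S R"
| trans: "(u, v) \<in> presented_cong S R \<Longrightarrow> (v, w) \<in> presented_cong S R \<Longrightarrow> (u, w) \<in> presented_cong S R"
| append: "(u, u') \<in> presented_cong S R \<Longrightarrow> (v, v') \<in> presented_cong S R
    \<Longrightarrow> (u @ v, u' @ v') \<in> presented_cong S R"
| cancel: "x \<in> S \<Longrightarrow> ([(x, e), (x, \<not> e)], []) \<in> presented_cong S R"
| rel: "(u, v) \<in> R \<Longrightarrow> u \<in> words S \<Longrightarrow> v \<in> words S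
    \<Longrightarrow> (u, v) \<in> presented_cong S R"

definition presented_group :: "'a set \<Rightarrow> ('a word \<times> 'a word) set \<Rightarrow> 'a word set monoid" where
  "presented_group S R =
    \<lparr>carrier = words S // presented_cong S R,
     monoid.mult = (\<lambda>A B. \<Union>u\<in>A. \<Union>v\<in>B. presented_cong S R `` {u @ v}),
     one = presented_cong S R `` {[]}\<rparr>"

lemma presented_cong_words:
  "(u, v) \<in> presented_cong S R \<Longrightarrow> u \<in> words S \<and> v \<in> words S"
  by (induction rule: presented_cong.induct) auto

lemma equiv_presented_cong: "equiv (words S) (presented_cong S R)"
proof (rule equivI)
  show "presented_cong S R \<subseteq> words S \<times> words S"
    using presented_cong_words by fastforce
  show "refl_on (words S) (presented_cong S R)"
    by (auto simp: refl_on_def intro!: presented_cong.refl)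
  show "sym (presented_cong S R)"
    by (rule symI) (rule presented_cong.sym)
  show "trans (presented_cong S R)"
    by (rule transI) (rule presented_cong.trans)
qed

lemma presented_class_eq_iff:
  assumes "u \<in> words S" "v \<in> words S"
  shows "presented_cong S R `` {u} = presented_cong S R `` {v} \<longleftrightarrow> (u, v) \<in> presented_cong S R"
  using eq_equiv_class_iff[OF equiv_presented_cong assms] .

lemma presented_group_mult:
  assumes "u \<in> words S" "v \<in> words S"
  shows "(presented_cong S R `` {u}) \<otimes>\<^bsub>presented_group S R\<^esub> (presented_cong S R `` {v})
    = presented_cong S R `` {u @ v}"
proof -
  have "congruent2 (presented_cong S R) (presented_cong S R) (\<lambda>u v. presented_cong S R `` {u @ v})"
  proof (rule congruent2I[OF equiv_presented_cong equiv_presented_cong])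
    fix a b c
    assume "(a, b) \<in> presented_cong S R" "c \<in> words S"
    then have "(a @ c, b @ c) \<in> presented_cong S R"
      by (intro presented_cong.append presented_cong.refl)
    then show "presented_cong S R `` {a @ c} = presented_cong S R `` {b @ c}"
      by (rule equiv_class_eq[OF equiv_presented_cong])
  next
    fix a b c
    assume "(a, b) \<in> presented_cong S R" "c \<in> words S"
    then have "(c @ a, c @ b) \<in> presented_cong S R"
      by (intro presented_cong.append presented_cong.refl)
    then show "presented_cong S R `` {c @ a} = presented_cong S R `` {c @ b}"
      by (rule equiv_class_eq[OF equiv_presented_cong])
  qed
  from UN_equiv_class2[OF equiv_presented_cong equiv_presented_cong this assms]
  show ?thesis by (simp add: presented_group_def)
qed

lemma presented_group_carrierE:
  assumes "A \<in> carrier (presented_group S R)"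
  obtains w where "w \<in> words S" "A = presented_cong S R `` {w}"
  using assms by (auto simp: presented_group_def elim!: quotientE)

lemma presented_group_carrierI:
  "w \<in> words S \<Longrightarrow> presented_cong S R `` {w} \<in> carrier (presented_group S R)"
  by (simp add: presented_group_def quotientI)

lemma presented_group_one: "\<one>\<^bsub>presented_group S R\<^esub> = presented_cong S R `` {[]}"
  by (simp add: presented_group_def)

lemma presented_cong_inverse_word:
  assumes "w \<in> words S"
  shows "(rev (map (apsnd Not) w) @ w, []) \<in> presented_cong S R"
  using assms
proof (induction w)
  case Nil
  then show ?case by (simp add: presented_cong.refl)
next
  case (Cons p w)
  obtain x e where p: "p = (x, e)" by (cases p)
  let ?v = "rev (map (apsnd Not) w)"
  have x: "x \<in> S" and w: "w \<in> words S" using Cons.hyps p by auto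
  have v: "?v \<in> words S" using w by (auto simp: in_lists_conv_set)
  have "([(x, \<not> e), (x, e)], []) \<in> presented_cong S R"
    using presented_cong.cancel[OF x, of "\<not> e"] by simp
  from presented_cong.append[OF this presented_cong.refl[OF w]]
  have "([(x, \<not> e), (x, e)] @ w, w) \<in> presented_cong S R" by simp
  from presented_cong.append[OF presented_cong.refl[OF v] this]
  have "(?v @ [(x, \<not> e), (x, e)] @ w, ?v @ w) \<in> presented_cong S R" .
  from presented_cong.trans[OF this Cons.IH] p show ?case by simp
qed

lemma group_presented_group: "group (presented_group S R)"
proof (rule groupI)
  fix A assume "A \<in> carrier (presented_group S R)"
  then obtain w where w: "w \<in> words S" "A = presented_cong S R `` {w}"
    by (rule presented_group_carrierE)
  let ?v = "rev (map (apsnd Not) w)"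
  have v: "?v \<in> words S" using w(1) by (auto simp: in_lists_conv_set)
  show "\<one>\<^bsub>presented_group S R\<^esub> \<otimes>\<^bsub>presented_group S R\<^esub> A = A"
    using presented_group_mult[of "[]" S w R] w by (simp add: presented_group_one)
  have "(presented_cong S R `` {?v}) \<otimes>\<^bsub>presented_group S R\<^esub> A = \<one>\<^bsub>presented_group S R\<^esub>"
    unfolding w(2) presented_group_mult[OF v w(1)] presented_group_one
    by (rule equiv_class_eq[OF equiv_presented_cong presented_cong_inverse_word[OF w(1)]])
  then show "\<exists>B\<in>carrier (presented_group S R). B \<otimes>\<^bsub>presented_group S R\<^esub> A = \<one>\<^bsub>presented_group S R\<^esub>"
    using presented_group_carrierI[OF v] by blast
next
  fix A B assume "A \<in> carrier (presented_group S R)" "B \<in> carrier (presented_group S R)"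
  then show "A \<otimes>\<^bsub>presented_group S R\<^esub> B \<in> carrier (presented_group S R)"
    by (elim presented_group_carrierE) (simp only: presented_group_mult, rule presented_group_carrierI, simp)
next
  fix A B C
  assume "A \<in> carrier (presented_group S R)" "B \<in> carrier (presented_group S R)"
    "C \<in> carrier (presented_group S R)"
  then show "A \<otimes>\<^bsub>presented_group S R\<^esub> B \<otimes>\<^bsub>presented_group S R\<^esub> C
    = A \<otimes>\<^bsub>presented_group S R\<^esub> (B \<otimes>\<^bsub>presented_group S R\<^esub> C)"
    by (elim presented_group_carrierE)
      (simp only: presented_group_mult append_in_lists_conv simp_thms append_assoc)
next
  show "\<one>\<^bsub>presented_group S R\<^esub> \<in> carrier (presented_group S R)"
    unfolding presented_group_one by (rule presented_group_carrierI) simp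
qed


section \<open>Racks\<close>

record 'a rack = "'a partial_object" +
  rack_op :: "'a \<Rightarrow> 'a \<Rightarrow> 'a" (infixl "\<triangleleft>\<index>" 70)
  rack_inv_op :: "'a \<Rightarrow> 'a \<Rightarrow> 'a" (infixl "\<triangleleft>\<inverse>\<index>" 70)

locale rack =
  fixes X :: "('a, 'c) rack_scheme" (structure)
  assumes op_closed: "x \<in> carrier X \<Longrightarrow> y \<in> carrier X \<Longrightarrow> x \<triangleleft> y \<in> carrier X"
    and inv_op_closed: "x \<in> carrier X \<Longrightarrow> y \<in> carrier X \<Longrightarrow> x \<triangleleft>\<inverse> y \<in> carrier X"
    and op_inv_op: "x \<in> carrier X \<Longrightarrow> y \<in> carrier X \<Longrightarrow> (x \<triangleleft> y) \<triangleleft>\<inverse> y = x"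
    and inv_op_op: "x \<in> carrier X \<Longrightarrow> y \<in> carrier X \<Longrightarrow> (x \<triangleleft>\<inverse> y) \<triangleleft> y = x"
    and self_distrib: "x \<in> carrier X \<Longrightarrow> y \<in> carrier X \<Longrightarrow> z \<in> carrier X
      \<Longrightarrow> (x \<triangleleft> y) \<triangleleft> z = (x \<triangleleft> z) \<triangleleft> (y \<triangleleft> z)"

definition rack_hom :: "('a, 'c) rack_scheme \<Rightarrow> ('b, 'd) rack_scheme \<Rightarrow> ('a \<Rightarrow> 'b) set" where
  "rack_hom X Y = {f \<in> carrier X \<rightarrow> carrier Y. \<forall>x\<in>carrier X. \<forall>y\<in>carrier X.
    f (x \<triangleleft>\<^bsub>X\<^esub> y) = f x \<triangleleft>\<^bsub>Y\<^esub> f y \<and> f (x \<triangleleft>\<inverse>\<^bsub>X\<^esub> y) = f x \<triangleleft>\<inverse>\<^bsub>Y\<^esub> f y}"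

lemma rack_homI:
  assumes "rack X" "rack Y" "f \<in> carrier X \<rightarrow> carrier Y"
    and hom: "\<And>x y. x \<in> carrier X \<Longrightarrow> y \<in> carrier X \<Longrightarrow> f (x \<triangleleft>\<^bsub>X\<^esub> y) = f x \<triangleleft>\<^bsub>Y\<^esub> f y"
  shows "f \<in> rack_hom X Y"
proof -
  interpret X: rack X by fact
  interpret Y: rack Y by fact
  have "f (x \<triangleleft>\<inverse>\<^bsub>X\<^esub> y) = f x \<triangleleft>\<inverse>\<^bsub>Y\<^esub> f y" if "x \<in> carrier X" "y \<in> carrier X" for x y
  proof -
    have "f x = f (x \<triangleleft>\<inverse>\<^bsub>X\<^esub> y) \<triangleleft>\<^bsub>Y\<^esub> f y"
      using hom[OF X.inv_op_closed[OF that] that(2)] X.inv_op_op[OF that] by simp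
    then show ?thesis
      using Y.op_inv_op[of "f (x \<triangleleft>\<inverse>\<^bsub>X\<^esub> y)" "f y"] X.inv_op_closed[OF that] that assms(3)
      by (simp add: Pi_iff)
  qed
  with assms show ?thesis by (simp add: rack_hom_def)
qed

definition Eq_on :: "'a set \<Rightarrow> ('a \<Rightarrow> 'b) \<Rightarrow> ('a \<times> 'a) set" where
  "Eq_on A f = {(a, b). a \<in> A \<and> b \<in> A \<and> f a = f b}"


section \<open>The group of paths of a rack\<close>

definition Pth_rels :: "('a, 'c) rack_scheme \<Rightarrow> ('a word \<times> 'a word) set" where
  "Pth_rels X = {([(x \<triangleleft>\<^bsub>X\<^esub> a, True)], [(a, False), (x, True), (a, True)]) | x a.
    x \<in> carrier X \<and> a \<in> carrier X}"

definition Pth :: "('a, 'c) rack_scheme \<Rightarrow> 'a word set monoid" where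
  "Pth X = presented_group (carrier X) (Pth_rels X)"

definition Pth_gen :: "('a, 'c) rack_scheme \<Rightarrow> 'a \<Rightarrow> 'a word set" where
  "Pth_gen X x = presented_cong (carrier X) (Pth_rels X) `` {[(x, True)]}"

text \<open>
  On the class of a word, \<open>Pth_map X Y f\<close> applies \<open>f\<close> letterwise; see \<open>Pth_map_hom\<close> and
  \<open>Pth_map_gen\<close> below.
\<close>

definition Pth_map :: "('a, 'c) rack_scheme \<Rightarrow> ('b, 'd) rack_scheme \<Rightarrow> ('a \<Rightarrow> 'b)
    \<Rightarrow> 'a word set \<Rightarrow> 'b word set" where
  "Pth_map X Y f A =
    (\<Union>w\<in>A. presented_cong (carrier Y) (Pth_rels Y) `` {map (apfst f) w})"

lemma group_Pth: "group (Pth X)"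
  unfolding Pth_def by (rule group_presented_group)

lemma Pth_gen_closed: "x \<in> carrier X \<Longrightarrow> Pth_gen X x \<in> carrier (Pth X)"
  unfolding Pth_gen_def Pth_def by (rule presented_group_carrierI) simp

lemma Pth_gen_inv:
  assumes "x \<in> carrier X"
  shows "inv\<^bsub>Pth X\<^esub> Pth_gen X x = presented_cong (carrier X) (Pth_rels X) `` {[(x, False)]}"
proof -
  interpret group "Pth X" by (rule group_Pth)
  let ?c = "presented_cong (carrier X) (Pth_rels X)"
  have "(?c `` {[(x, False)]}) \<otimes>\<^bsub>Pth X\<^esub> Pth_gen X x = ?c `` {[(x, False), (x, True)]}"
    unfolding Pth_gen_def Pth_def using assms by (subst presented_group_mult) auto
  also have "\<dots> = \<one>\<^bsub>Pth X\<^esub>"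
    unfolding Pth_def presented_group_one
    using equiv_class_eq[OF equiv_presented_cong presented_cong.cancel[OF assms, of False]] by simp
  finally show ?thesis
    using assms Pth_gen_closed presented_group_carrierI[of "[(x, False)]" "carrier X" "Pth_rels X"]
    by (intro inv_equality) (auto simp: Pth_def)
qed

lemma Pth_relation:
  assumes "rack X" "x \<in> carrier X" "a \<in> carrier X"
  shows "Pth_gen X (x \<triangleleft>\<^bsub>X\<^esub> a)
    = inv\<^bsub>Pth X\<^esub> Pth_gen X a \<otimes>\<^bsub>Pth X\<^esub> Pth_gen X x \<otimes>\<^bsub>Pth X\<^esub> Pth_gen X a"
proof -
  let ?c = "presented_cong (carrier X) (Pth_rels X)"
  have "([(x \<triangleleft>\<^bsub>X\<^esub> a, True)], [(a, False), (x, True), (a, True)]) \<in> ?c"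
    using assms rack.op_closed[OF assms] by (intro presented_cong.rel) (auto simp: Pth_rels_def)
  from equiv_class_eq[OF equiv_presented_cong this]
  have "Pth_gen X (x \<triangleleft>\<^bsub>X\<^esub> a) = ?c `` {[(a, False), (x, True), (a, True)]}"
    by (simp add: Pth_gen_def)
  also have "\<dots> = (?c `` {[(a, False)]}) \<otimes>\<^bsub>Pth X\<^esub> Pth_gen X x \<otimes>\<^bsub>Pth X\<^esub> Pth_gen X a"
    using assms by (simp add: Pth_def Pth_gen_def presented_group_mult)
  finally show ?thesis by (simp add: Pth_gen_inv[OF assms(3)])
qed

lemma Pth_generated: "generate (Pth X) (Pth_gen X ` carrier X) = carrier (Pth X)" (is "?G = _")
proof
  interpret group "Pth X" by (rule group_Pth)
  show "?G \<subseteq> carrier (Pth X)"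
    by (rule generate_incl) (auto intro: Pth_gen_closed)
  let ?c = "presented_cong (carrier X) (Pth_rels X)"
  have "?c `` {w} \<in> ?G" if "w \<in> words (carrier X)" for w
    using that
  proof (induction w)
    case Nil
    show ?case
      using generate.one[of "Pth X"] by (simp add: Pth_def presented_group_one)
  next
    case (Cons p w)
    obtain x e where p: "p = (x, e)" by (cases p)
    have x: "x \<in> carrier X" and w: "w \<in> words (carrier X)" using Cons.hyps p by auto
    have "?c `` {[p]} \<in> ?G"
    proof (cases e)
      case True
      then have "?c `` {[p]} = Pth_gen X x" by (simp add: p Pth_gen_def)
      then show ?thesis using x by (auto intro: generate.incl)
    next
      case False
      then have "?c `` {[p]} = inv\<^bsub>Pth X\<^esub> Pth_gen X x" by (simp add: p Pth_gen_inv[OF x])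
      then show ?thesis using x by (auto intro: generate.inv)
    qed
    from generate.eng[OF this Cons.IH] show ?case
      using x w p by (simp add: Pth_def presented_group_mult)
  qed
  then show "carrier (Pth X) \<subseteq> ?G"
    by (auto simp: Pth_def elim!: presented_group_carrierE)
qed

lemma Pth_map_cong:
  assumes "f \<in> rack_hom X Y" "(u, v) \<in> presented_cong (carrier X) (Pth_rels X)"
  shows "(map (apfst f) u, map (apfst f) v) \<in> presented_cong (carrier Y) (Pth_rels Y)"
  using assms(2)
proof (induction rule: presented_cong.induct)
  case (refl w)
  then show ?case
    using assms(1) by (intro presented_cong.refl) (fastforce simp: rack_hom_def in_lists_conv_set)
next
  case (cancel x e)
  then show ?case
    using assms(1) presented_cong.cancel[of "f x" "carrier Y" e] by (auto simp: rack_hom_def)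
next
  case (rel u v)
  then show ?case
    using assms(1) by (intro presented_cong.rel) (fastforce simp: Pth_rels_def rack_hom_def)+
qed (auto intro: presented_cong.intros)

lemma Pth_map_class:
  assumes "f \<in> rack_hom X Y" "w \<in> words (carrier X)"
  shows "Pth_map X Y f (presented_cong (carrier X) (Pth_rels X) `` {w})
    = presented_cong (carrier Y) (Pth_rels Y) `` {map (apfst f) w}"
proof -
  have "(\<lambda>w. presented_cong (carrier Y) (Pth_rels Y) `` {map (apfst f) w})
      respects presented_cong (carrier X) (Pth_rels X)"
    by (rule congruentI)
      (rule equiv_class_eq[OF equiv_presented_cong Pth_map_cong[OF assms(1)]])
  from UN_equiv_class[OF equiv_presented_cong this assms(2)]
  show ?thesis by (simp add: Pth_map_def)
qed

lemma Pth_map_gen: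
  assumes "f \<in> rack_hom X Y" "x \<in> carrier X"
  shows "Pth_map X Y f (Pth_gen X x) = Pth_gen Y (f x)"
  using Pth_map_class[OF assms(1), of "[(x, True)]"] assms(2) by (simp add: Pth_gen_def)

lemma Pth_map_hom:
  assumes "f \<in> rack_hom X Y"
  shows "Pth_map X Y f \<in> hom (Pth X) (Pth Y)"
proof -
  have *: "map (apfst f) w \<in> words (carrier Y)" if "w \<in> words (carrier X)" for w
    using that assms by (fastforce simp: rack_hom_def in_lists_conv_set)
  show ?thesis
  proof (rule homI)
    fix A assume "A \<in> carrier (Pth X)"
    then obtain u where u: "u \<in> words (carrier X)"
      "A = presented_cong (carrier X) (Pth_rels X) `` {u}"
      unfolding Pth_def by (rule presented_group_carrierE)
    then show "Pth_map X Y f A \<in> carrier (Pth Y)"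
      unfolding u(2) Pth_map_class[OF assms u(1)] Pth_def
      by (intro presented_group_carrierI *)
    fix B assume "B \<in> carrier (Pth X)"
    then obtain v where v: "v \<in> words (carrier X)"
      "B = presented_cong (carrier X) (Pth_rels X) `` {v}"
      unfolding Pth_def by (rule presented_group_carrierE)
    have uv: "u @ v \<in> words (carrier X)" using u(1) v(1) by simp
    show "Pth_map X Y f (A \<otimes>\<^bsub>Pth X\<^esub> B) = Pth_map X Y f A \<otimes>\<^bsub>Pth Y\<^esub> Pth_map X Y f B"
      unfolding u(2) v(2) Pth_def presented_group_mult[OF u(1) v(1)]
        Pth_map_class[OF assms u(1)] Pth_map_class[OF assms v(1)] Pth_map_class[OF assms uv]
        presented_group_mult[OF *[OF u(1)] *[OF v(1)]]
      by simp
  qed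
qed


section \<open>Symmetric paths\<close>

definition symmetric_to :: "('g, 'm) monoid_scheme \<Rightarrow> ('g \<Rightarrow> 'h) \<Rightarrow> 'g set \<Rightarrow> 'g \<Rightarrow> 'g \<Rightarrow> bool" where
  "symmetric_to G \<phi> E g\<^sub>a g\<^sub>b \<longleftrightarrow>
    (\<exists>(n::nat) a b (\<delta> :: nat \<Rightarrow> int).
      (\<forall>i\<in>{1..n}. (a i, b i) \<in> (E \<times> E) \<inter> Eq_on (carrier G) \<phi> \<and> \<delta> i \<in> {-1, 1}) \<and>
      g\<^sub>a = foldr (\<otimes>\<^bsub>G\<^esub>) (map (\<lambda>i. a i [^]\<^bsub>G\<^esub> \<delta> i) [1..<Suc n]) \<one>\<^bsub>G\<^esub> \<and>
      g\<^sub>b = foldr (\<otimes>\<^bsub>G\<^esub>) (map (\<lambda>i. b i [^]\<^bsub>G\<^esub> \<delta> i) [1..<Suc n]) \<one>\<^bsub>G\<^esub>)"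

definition symmetric_paths :: "('g, 'm) monoid_scheme \<Rightarrow> ('g \<Rightarrow> 'h) \<Rightarrow> 'g set \<Rightarrow> 'g set" where
  "symmetric_paths G \<phi> E = {g\<^sub>a \<otimes>\<^bsub>G\<^esub> inv\<^bsub>G\<^esub> g\<^sub>b | g\<^sub>a g\<^sub>b. symmetric_to G \<phi> E g\<^sub>a g\<^sub>b}"

definition normal_closure :: "('g, 'm) monoid_scheme \<Rightarrow> 'g set \<Rightarrow> 'g set" where
  "normal_closure G S = \<Inter> {N. N \<lhd> G \<and> S \<subseteq> N}"

end

theory Submission
  imports Defs
begin

text \<open>
  Three subsets of \<open>Pth X\<close> are compared: the normal closure \<open>N\<close> of the elements
  \<open>a b\<inverse>\<close> with \<open>f a = f b\<close>, the set \<open>K\<close> of symmetric paths, and the kernel. They are equal because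
  \<open>N \<subseteq> K \<subseteq> Ker \<subseteq> N\<close>.

  For the first two inclusions nothing about racks is needed. The pairs \<open>(g, h)\<close> of elements
  symmetric to each other form a subgroup of \<open>G \<times> G\<close> which is closed under swapping the two
  components and, as the set \<open>E\<close> generates \<open>G\<close>, contains the diagonal. A reflexive and symmetric
  subgroup of \<open>G \<times> G\<close> is a congruence on \<open>G\<close>, and \<open>K\<close> is the class of the identity, so it is a
  normal subgroup (\<open>symmetric_paths_normal\<close>). It lies in the kernel since symmetric elements have
  equal images letter by letter, and it contains the generators of \<open>N\<close>. Generators \<open>a\<close>, \<open>b\<close> of
  \<open>Pth X\<close> may have the same image in \<open>Pth Y\<close> even if \<open>f a \<noteq> f b\<close>, so \<open>K \<subseteq> N\<close> is not visible letter
  by letter and is obtained only through the kernel.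

  The inclusion \<open>Ker \<subseteq> N\<close> uses that \<open>Pth Y\<close> is presented by the relations of the rack \<open>Y\<close>. Any
  homomorphism on \<open>Pth X\<close> that identifies \<open>a\<close> and \<open>b\<close> whenever \<open>f a = f b\<close> is determined on a word
  by the image of this word under \<open>f\<close>, and every relation of \<open>Pth Y\<close> lifts along the surjection
  \<open>f\<close> to a relation of \<open>Pth X\<close>; hence such a homomorphism factors through \<open>Pth Y\<close>
  (\<open>Pth_hom_eq_of_image_cong\<close>) and is trivial on the kernel. The quotient map to
  \<open>Pth X Mod N\<close> is such a homomorphism.
\<close>

section \<open>Symmetric elements form a congruence\<close>

lemma (in monoid) foldr_mult_closed:
  "set xs \<subseteq> carrier G \<Longrightarrow> foldr (\<otimes>) xs \<one> \<in> carrier G"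
  by (induction xs) auto

lemma (in monoid) foldr_mult_append:
  "set xs \<subseteq> carrier G \<Longrightarrow> set ys \<subseteq> carrier G
    \<Longrightarrow> foldr (\<otimes>) (xs @ ys) \<one> = foldr (\<otimes>) xs \<one> \<otimes> foldr (\<otimes>) ys \<one>"
  by (induction xs) (auto simp: m_assoc foldr_mult_closed simp del: foldr_append)

text \<open>
  Lists of triples can be concatenated and mapped over, which indexed families only
  allow after shifting indices.
\<close>

lemma symmetric_to_iff_list:
  "symmetric_to G \<phi> E g h \<longleftrightarrow>
    (\<exists>ts. (\<forall>(a, b, d)\<in>set ts. (a, b) \<in> (E \<times> E) \<inter> Eq_on (carrier G) \<phi> \<and> d \<in> {-1, 1 :: int}) \<and>
      g = foldr (\<otimes>\<^bsub>G\<^esub>) (map (\<lambda>(a, b, d). a [^]\<^bsub>G\<^esub> d) ts) \<one>\<^bsub>G\<^esub> \<and>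
      h = foldr (\<otimes>\<^bsub>G\<^esub>) (map (\<lambda>(a, b, d). b [^]\<^bsub>G\<^esub> d) ts) \<one>\<^bsub>G\<^esub>)"
  (is "_ \<longleftrightarrow> (\<exists>ts. ?P ts)")
proof
  assume "symmetric_to G \<phi> E g h"
  then obtain n a b and d :: "nat \<Rightarrow> int"
    where "\<forall>i\<in>{1..n}. (a i, b i) \<in> (E \<times> E) \<inter> Eq_on (carrier G) \<phi> \<and> d i \<in> {-1, 1}"
      and "g = foldr (\<otimes>\<^bsub>G\<^esub>) (map (\<lambda>i. a i [^]\<^bsub>G\<^esub> d i) [1..<Suc n]) \<one>\<^bsub>G\<^esub>"
      and "h = foldr (\<otimes>\<^bsub>G\<^esub>) (map (\<lambda>i. b i [^]\<^bsub>G\<^esub> d i) [1..<Suc n]) \<one>\<^bsub>G\<^esub>"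
    unfolding symmetric_to_def by blast
  then have "?P (map (\<lambda>i. (a i, b i, d i)) [1..<Suc n])"
    by (auto simp: o_def simp del: upt_Suc)
  then show "\<exists>ts. ?P ts" ..
next
  assume "\<exists>ts. ?P ts"
  then obtain ts where ts: "?P ts" ..
  \<comment> \<open>The families start at index 1, list positions at 0.\<close>
  let ?t = "\<lambda>i. ts ! (i - 1)"
  have reindex: "map (\<lambda>i. F (?t i)) [1..<Suc (length ts)] = map F ts" for F :: "_ \<Rightarrow> 'a"
    by (rule nth_equalityI) (simp_all del: upt_Suc)
  have "(fst (?t i), fst (snd (?t i))) \<in> (E \<times> E) \<inter> Eq_on (carrier G) \<phi>
      \<and> snd (snd (?t i)) \<in> {-1, 1}"
    if "i \<in> {1..length ts}" for i
  proof -
    have "?t i \<in> set ts" using that by (intro nth_mem) auto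
    with ts show ?thesis by (auto simp: case_prod_unfold)
  qed
  then show "symmetric_to G \<phi> E g h"
    unfolding symmetric_to_def
    using ts reindex[of "\<lambda>t. fst t [^]\<^bsub>G\<^esub> snd (snd t)"]
      reindex[of "\<lambda>t. fst (snd t) [^]\<^bsub>G\<^esub> snd (snd t)"]
    by (intro exI[of _ "length ts"] exI[of _ "\<lambda>i. fst (?t i)"]
        exI[of _ "\<lambda>i. fst (snd (?t i))"] exI[of _ "\<lambda>i. snd (snd (?t i))"])
      (simp add: case_prod_unfold del: upt_Suc)
qed

lemma symmetric_to_commute:
  assumes "symmetric_to G \<phi> E g h"
  shows "symmetric_to G \<phi> E h g"
proof -
  obtain ts
    where "\<forall>(a, b, d)\<in>set ts. (a, b) \<in> (E \<times> E) \<inter> Eq_on (carrier G) \<phi> \<and> d \<in> {-1, 1 :: int}"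
      and "g = foldr (\<otimes>\<^bsub>G\<^esub>) (map (\<lambda>(a, b, d). a [^]\<^bsub>G\<^esub> d) ts) \<one>\<^bsub>G\<^esub>"
      and "h = foldr (\<otimes>\<^bsub>G\<^esub>) (map (\<lambda>(a, b, d). b [^]\<^bsub>G\<^esub> d) ts) \<one>\<^bsub>G\<^esub>"
    using assms unfolding symmetric_to_iff_list by blast
  then show ?thesis
    unfolding symmetric_to_iff_list
    by (intro exI[of _ "map (\<lambda>(a, b, d). (b, a, d)) ts"])
      (simp add: Eq_on_def case_prod_unfold o_def)
qed

context group_hom
begin

lemma symmetric_to_one: "symmetric_to G h E \<one> \<one>"
  unfolding symmetric_to_iff_list by (intro exI[of _ "[]"]) simp

lemma symmetric_to_gen:
  assumes "a \<in> E" "b \<in> E" "E \<subseteq> carrier G" "h a = h b"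
  shows "symmetric_to G h E a b" and "symmetric_to G h E (inv a) (inv b)"
proof -
  have *: "a \<in> carrier G" "b \<in> carrier G" using assms by auto
  show "symmetric_to G h E a b"
    unfolding symmetric_to_iff_list
    using assms * by (intro exI[of _ "[(a, b, 1)]"]) (simp add: Eq_on_def)
  show "symmetric_to G h E (inv a) (inv b)"
    unfolding symmetric_to_iff_list
    using assms * by (intro exI[of _ "[(a, b, -1)]"]) (simp add: Eq_on_def G.int_pow_neg)
qed

lemma symmetric_to_mult:
  assumes "symmetric_to G h E g g'" "symmetric_to G h E k k'"
  shows "symmetric_to G h E (g \<otimes> k) (g' \<otimes> k')"
proof -
  let ?ok = "\<lambda>ts. \<forall>(a, b, d)\<in>set ts. (a, b) \<in> (E \<times> E) \<inter> Eq_on (carrier G) h \<and> d \<in> {-1, 1 :: int}"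
  let ?l = "map (\<lambda>(a, b, d). a [^] d)" and ?r = "map (\<lambda>(a, b, d). b [^] d)"
  obtain s where s: "?ok s" "g = foldr (\<otimes>) (?l s) \<one>" "g' = foldr (\<otimes>) (?r s) \<one>"
    using assms(1) unfolding symmetric_to_iff_list by blast
  obtain t where t: "?ok t" "k = foldr (\<otimes>) (?l t) \<one>" "k' = foldr (\<otimes>) (?r t) \<one>"
    using assms(2) unfolding symmetric_to_iff_list by blast
  have closed: "set (?l ts) \<subseteq> carrier G" "set (?r ts) \<subseteq> carrier G" if "?ok ts" for ts
    using that by (auto simp: Eq_on_def)
  show ?thesis
    unfolding symmetric_to_iff_list
    using s t closed[OF s(1)] closed[OF t(1)]
    by (intro exI[of _ "s @ t"])
      (simp only: map_append set_append ball_Un G.foldr_mult_append simp_thms)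
qed

lemma symmetric_to_image_eq:
  assumes "symmetric_to G h E g g'"
  shows "g \<in> carrier G \<and> g' \<in> carrier G \<and> h g = h g'"
proof -
  let ?ok = "\<lambda>ts. \<forall>(a, b, d)\<in>set ts. (a, b) \<in> (E \<times> E) \<inter> Eq_on (carrier G) h \<and> d \<in> {-1, 1 :: int}"
  let ?l = "\<lambda>ts. foldr (\<otimes>) (map (\<lambda>(a, b, d). a [^] d) ts) \<one>"
    and ?r = "\<lambda>ts. foldr (\<otimes>) (map (\<lambda>(a, b, d). b [^] d) ts) \<one>"
  have "?l ts \<in> carrier G \<and> ?r ts \<in> carrier G \<and> h (?l ts) = h (?r ts)" if "?ok ts" for ts
    using that by (induction ts) (auto simp: Eq_on_def hom_int_pow)
  with assms show ?thesis unfolding symmetric_to_iff_list by blast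
qed

lemma symmetric_to_refl:
  assumes "E \<subseteq> carrier G" "g \<in> generate G E"
  shows "symmetric_to G h E g g"
  using assms(2)
  by induction (auto intro: symmetric_to_one symmetric_to_gen[OF _ _ assms(1)] symmetric_to_mult)

lemma symmetric_paths_subset_kernel: "symmetric_paths G h E \<subseteq> kernel G H h"
  by (auto simp: symmetric_paths_def kernel_def dest!: symmetric_to_image_eq)

text \<open>
  Multiplying a pair by diagonal elements keeps it symmetric. For the product of
  \<open>g g'\<inverse>\<close> and \<open>k k'\<inverse>\<close> the pairs \<open>(g, g')\<close> and \<open>(k, k')\<close> are joined by the diagonal pair of
  \<open>g'\<inverse>\<close>, and conjugation by \<open>x\<close> amounts to multiplying by the diagonal pair of \<open>x\<close> on the left.
\<close>

lemma symmetric_paths_normal: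
  assumes E: "E \<subseteq> carrier G" and gen: "generate G E = carrier G"
  shows "symmetric_paths G h E \<lhd> G"
proof -
  let ?K = "symmetric_paths G h E" and ?S = "symmetric_to G h E"
  have refl: "?S g g" if "g \<in> carrier G" for g
    using symmetric_to_refl[OF E] that gen by simp
  note closed = symmetric_to_image_eq
  have "subgroup ?K G"
  proof (rule G.subgroupI)
    show "?K \<subseteq> carrier G"
      by (auto simp: symmetric_paths_def dest: closed)
    show "?K \<noteq> {}"
      unfolding symmetric_paths_def using symmetric_to_one by blast
  next
    fix u assume "u \<in> ?K"
    then obtain g g' where u: "?S g g'" "u = g \<otimes> inv g'"
      unfolding symmetric_paths_def by blast
    then have "inv u = g' \<otimes> inv g"
      using closed[OF u(1)] by (simp add: G.inv_mult_group)
    then show "inv u \<in> ?K"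
      unfolding symmetric_paths_def using symmetric_to_commute[OF u(1)] by blast
    fix v assume "v \<in> ?K"
    then obtain k k' where v: "?S k k'" "v = k \<otimes> inv k'"
      unfolding symmetric_paths_def by blast
    have c: "g \<in> carrier G" "g' \<in> carrier G" "k \<in> carrier G" "k' \<in> carrier G"
      using closed[OF u(1)] closed[OF v(1)] by auto
    have "?S (g \<otimes> inv g' \<otimes> k) (g' \<otimes> inv g' \<otimes> k')"
      using u v c by (intro symmetric_to_mult refl) auto
    moreover have "u \<otimes> v = (g \<otimes> inv g' \<otimes> k) \<otimes> inv (g' \<otimes> inv g' \<otimes> k')"
      using c by (simp add: u v G.m_assoc)
    ultimately show "u \<otimes> v \<in> ?K"
      unfolding symmetric_paths_def by blast
  qed
  moreover have "x \<otimes> u \<otimes> inv x \<in> ?K" if x: "x \<in> carrier G" and u_in: "u \<in> ?K" for x u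
  proof -
    obtain g g' where u: "?S g g'" "u = g \<otimes> inv g'"
      using u_in unfolding symmetric_paths_def by blast
    have "?S (x \<otimes> g) (x \<otimes> g')"
      using u x by (intro symmetric_to_mult refl)
    moreover have "x \<otimes> u \<otimes> inv x = (x \<otimes> g) \<otimes> inv (x \<otimes> g')"
      using u x closed[OF u(1)] by (simp add: G.inv_mult_group G.m_assoc)
    ultimately show ?thesis
      unfolding symmetric_paths_def by blast
  qed
  ultimately show ?thesis
    by (simp add: G.normal_inv_iff)
qed

end

section \<open>Lifting relations along a surjective morphism\<close>

lemma words_lift:
  assumes "f ` A = B" "w \<in> words B"
  obtains w' where "w' \<in> words A" "map (apfst f) w' = w"
proof -
  have "B \<times> UNIV = apfst f ` (A \<times> (UNIV :: bool set))"
    unfolding assms(1)[symmetric] by force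
  then show thesis
    using assms(2) that by (auto simp: lists_image)
qed

abbreviation Pth_class :: "('a, 'c) rack_scheme \<Rightarrow> 'a word \<Rightarrow> 'a word set" where
  "Pth_class X w \<equiv> presented_cong (carrier X) (Pth_rels X) `` {w}"

lemma Pth_class_closed: "w \<in> words (carrier X) \<Longrightarrow> Pth_class X w \<in> carrier (Pth X)"
  unfolding Pth_def by (rule presented_group_carrierI)

lemma Pth_class_append:
  "u \<in> words (carrier X) \<Longrightarrow> v \<in> words (carrier X)
    \<Longrightarrow> Pth_class X (u @ v) = Pth_class X u \<otimes>\<^bsub>Pth X\<^esub> Pth_class X v"
  by (simp add: Pth_def presented_group_mult)

lemma Pth_class_Cons:
  "x \<in> carrier X \<Longrightarrow> w \<in> words (carrier X) \<Longrightarrow> Pth_class X ((x, e) # w)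
    = (if e then Pth_gen X x else inv\<^bsub>Pth X\<^esub> Pth_gen X x) \<otimes>\<^bsub>Pth X\<^esub> Pth_class X w"
  using Pth_class_append[of "[(x, e)]" X w] by (cases e) (simp_all add: Pth_gen_inv, simp_all add: Pth_gen_def)

lemma Pth_class_Nil: "Pth_class X [] = \<one>\<^bsub>Pth X\<^esub>"
  by (simp add: Pth_def presented_group_one)

text \<open>
  This is the factorization of \<open>h\<close> through \<open>Pth Y\<close>, stated on words. The lifts \<open>u'\<close> and \<open>v'\<close> are
  arbitrary because of transitivity: by surjectivity the middle word has a lift, and the induction
  hypotheses on its two sides must both apply to that lift.
\<close>

lemma Pth_hom_eq_of_image_cong:
  assumes X: "rack X" and f: "f \<in> rack_hom X Y" and surj: "f ` carrier X = carrier Y"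
    and h: "group_hom (Pth X) G h"
    and fibre: "\<And>a b. a \<in> carrier X \<Longrightarrow> b \<in> carrier X \<Longrightarrow> f a = f b
      \<Longrightarrow> h (Pth_gen X a) = h (Pth_gen X b)"
    and "(u, v) \<in> presented_cong (carrier Y) (Pth_rels Y)"
    and "u' \<in> words (carrier X)" "map (apfst f) u' = u"
    and "v' \<in> words (carrier X)" "map (apfst f) v' = v"
  shows "h (Pth_class X u') = h (Pth_class X v')"
proof -
  interpret group_hom "Pth X" G h by (rule h)
  note closed = Pth_gen_closed Pth_class_closed
  note eval = Pth_class_Cons Pth_class_Nil closed
  have h_append: "h (Pth_class X (u @ v)) = h (Pth_class X u) \<otimes>\<^bsub>G\<^esub> h (Pth_class X v)"
    if "u \<in> words (carrier X)" "v \<in> words (carrier X)" for u v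
    using that by (simp add: Pth_class_append closed)
  show ?thesis
    using assms(6-)
  proof (induction arbitrary: u' v' rule: presented_cong.induct)
    case (refl w)
    have "h (Pth_class X u) = h (Pth_class X v)"
      if "map (apfst f) u = map (apfst f) v" "u \<in> words (carrier X)" "v \<in> words (carrier X)" for u v
      using that
    proof (induction u arbitrary: v)
      case Nil
      then show ?case by simp
    next
      case (Cons p u)
      then obtain q v' where v: "v = q # v'" "apfst f p = apfst f q"
        "map (apfst f) u = map (apfst f) v'"
        by (cases v) auto
      then show ?case
        using Cons fibre[of "fst p" "fst q"] by (cases p; cases q) (auto simp: eval)
    qed
    then show ?case using refl by simp
  next
    case (sym u v)
    then show ?case by metis
  next
    case (trans u v w)
    have "v \<in> words (carrier Y)"
      using presented_cong_words[OF trans.hyps(1)] by simp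
    then obtain v0 where "v0 \<in> words (carrier X)" "map (apfst f) v0 = v"
      using words_lift[OF surj] by blast
    then show ?case using trans by metis
  next
    case (append u1 v1 u2 v2)
    obtain p q where u': "u' = p @ q" "map (apfst f) p = u1" "map (apfst f) q = u2"
      using append.prems(2) by (auto simp: map_eq_append_conv)
    obtain r s where v': "v' = r @ s" "map (apfst f) r = v1" "map (apfst f) s = v2"
      using append.prems(4) by (auto simp: map_eq_append_conv)
    have "h (Pth_class X p) = h (Pth_class X r)" "h (Pth_class X q) = h (Pth_class X s)"
      using append u' v' by auto
    then show ?case
      using u' v' append.prems h_append by simp
  next
    case (cancel y e)
    then obtain a b where "u' = [(a, e), (b, \<not> e)]" "f a = y" "f b = y" and v': "v' = []"
      by (auto simp: map_eq_Cons_conv)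
    moreover from this have "a \<in> carrier X" "b \<in> carrier X" using cancel.prems by auto
    ultimately show ?case
      using fibre[of a b] v' by (cases e) (simp_all add: eval)
  next
    case (rel u v)
    then obtain y c where "u = [(y \<triangleleft>\<^bsub>Y\<^esub> c, True)]" "v = [(c, False), (y, True), (c, True)]"
      by (auto simp: Pth_rels_def)
    then obtain z a x b where u': "u' = [(z, True)]" "f z = y \<triangleleft>\<^bsub>Y\<^esub> c"
      and v': "v' = [(a, False), (x, True), (b, True)]" "f a = c" "f x = y" "f b = c"
      using rel.prems by (auto simp: map_eq_Cons_conv)
    have in_X: "z \<in> carrier X" "a \<in> carrier X" "x \<in> carrier X" "b \<in> carrier X"
      using rel.prems u' v' by auto
    \<comment> \<open>The relation of \<open>Y\<close> lifts to the relation of \<open>X\<close> for \<open>x\<close> and \<open>a\<close>; the letters \<open>z\<close> and \<open>b\<close>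
      may differ from the lifted ones, but only within their fibres.\<close>
    have "f z = f (x \<triangleleft>\<^bsub>X\<^esub> a)"
      using f in_X u' v' by (simp add: rack_hom_def)
    then have "h (Pth_gen X z) = h (Pth_gen X (x \<triangleleft>\<^bsub>X\<^esub> a))"
      using in_X rack.op_closed[OF X] by (intro fibre)
    moreover have "h (Pth_gen X b) = h (Pth_gen X a)"
      using in_X v' by (intro fibre) simp_all
    ultimately show ?case
      using in_X u' v' by (simp add: eval Pth_relation[OF X] H.m_assoc)
  qed
qed

lemma kernel_Pth_map_subset_kernel:
  assumes X: "rack X" and f: "f \<in> rack_hom X Y" and surj: "f ` carrier X = carrier Y"
    and h: "group_hom (Pth X) G h"
    and fibre: "\<And>a b. a \<in> carrier X \<Longrightarrow> b \<in> carrier X \<Longrightarrow> f a = f b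
      \<Longrightarrow> h (Pth_gen X a) = h (Pth_gen X b)"
  shows "kernel (Pth X) (Pth Y) (Pth_map X Y f) \<subseteq> kernel (Pth X) G h"
proof
  interpret group_hom "Pth X" G h by (rule h)
  fix g assume g: "g \<in> kernel (Pth X) (Pth Y) (Pth_map X Y f)"
  then obtain w where w: "w \<in> words (carrier X)" "g = Pth_class X w"
    by (auto simp: kernel_def Pth_def elim: presented_group_carrierE)
  have "map (apfst f) w \<in> words (carrier Y)"
    using w(1) f by (fastforce simp: rack_hom_def in_lists_conv_set)
  moreover have "Pth_class Y (map (apfst f) w) = Pth_class Y []"
    using g w Pth_map_class[OF f w(1)] by (simp add: kernel_def Pth_class_Nil)
  ultimately have cong: "(map (apfst f) w, []) \<in> presented_cong (carrier Y) (Pth_rels Y)"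
    by (simp add: presented_class_eq_iff)
  have "h g = h (Pth_class X [])"
    unfolding w(2)
    by (intro Pth_hom_eq_of_image_cong[OF X f surj h _ cong] fibre) (simp_all add: w(1))
  then show "g \<in> kernel (Pth X) G h"
    using g by (simp add: kernel_def Pth_class_Nil)
qed

section \<open>The kernel of the induced homomorphism\<close>

lemma kernel_Pth_map_subset_normal_closure:
  assumes X: "rack X" and f: "f \<in> rack_hom X Y" and surj: "f ` carrier X = carrier Y"
  shows "kernel (Pth X) (Pth Y) (Pth_map X Y f) \<subseteq> normal_closure (Pth X)
    {Pth_gen X a \<otimes>\<^bsub>Pth X\<^esub> inv\<^bsub>Pth X\<^esub> Pth_gen X b | a b. (a, b) \<in> Eq_on (carrier X) f}"
  unfolding normal_closure_def
proof (rule Inter_greatest, safe)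
  fix N g
  assume N: "N \<lhd> Pth X" and g: "g \<in> kernel (Pth X) (Pth Y) (Pth_map X Y f)"
    and gens: "{Pth_gen X a \<otimes>\<^bsub>Pth X\<^esub> inv\<^bsub>Pth X\<^esub> Pth_gen X b | a b. (a, b) \<in> Eq_on (carrier X) f} \<subseteq> N"
  interpret normal N "Pth X" by (rule N)
  let ?q = "(#>\<^bsub>Pth X\<^esub>) N"
  have q: "group_hom (Pth X) (Pth X Mod N) ?q"
    by (simp add: group_hom_def group_hom_axioms_def group_Pth factorgroup_is_group r_coset_hom_Mod)
  have fibre: "N #>\<^bsub>Pth X\<^esub> Pth_gen X a = N #>\<^bsub>Pth X\<^esub> Pth_gen X b"
    if "a \<in> carrier X" "b \<in> carrier X" "f a = f b" for a b
  proof -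
    have "Pth_gen X a \<otimes>\<^bsub>Pth X\<^esub> inv\<^bsub>Pth X\<^esub> Pth_gen X b \<in> N"
      using gens that unfolding Eq_on_def by blast
    then have "Pth_gen X a \<in> N #>\<^bsub>Pth X\<^esub> Pth_gen X b"
      using that by (intro rcos_module_rev[OF group_Pth]) (simp_all add: Pth_gen_closed)
    then show ?thesis
      using that by (intro repr_independence[symmetric] subgroup_axioms) (simp_all add: Pth_gen_closed)
  qed
  have "g \<in> kernel (Pth X) (Pth X Mod N) ?q"
    using kernel_Pth_map_subset_kernel[OF X f surj q] fibre g by blast
  then have "g \<in> carrier (Pth X)" "N #>\<^bsub>Pth X\<^esub> g = N"
    by (auto simp: kernel_def FactGroup_def)
  then show "g \<in> N"
    using rcos_self[OF _ subgroup_axioms] by metis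
qed

theorem proposition2p4p6p2:
  fixes X :: "('a, 'c) rack_scheme" and Y :: "('b, 'd) rack_scheme" and f :: "'a \<Rightarrow> 'b"
  assumes "rack X" and "rack Y"
    and "f \<in> rack_hom X Y" and "f ` carrier X = carrier Y"
  shows "symmetric_paths (Pth X) (Pth_map X Y f) (Pth_gen X ` carrier X) \<lhd> Pth X
    \<and> kernel (Pth X) (Pth Y) (Pth_map X Y f)
      = symmetric_paths (Pth X) (Pth_map X Y f) (Pth_gen X ` carrier X)
    \<and> symmetric_paths (Pth X) (Pth_map X Y f) (Pth_gen X ` carrier X)
      = normal_closure (Pth X)
          {Pth_gen X a \<otimes>\<^bsub>Pth X\<^esub> inv\<^bsub>Pth X\<^esub> Pth_gen X b | a b. (a, b) \<in> Eq_on (carrier X) f}"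
    (is "?K \<lhd> _ \<and> ?ker = ?K \<and> ?K = normal_closure _ ?S")
proof -
  interpret group_hom "Pth X" "Pth Y" "Pth_map X Y f"
    using Pth_map_hom[OF assms(3)] by (simp add: group_hom_def group_hom_axioms_def group_Pth)
  have E: "Pth_gen X ` carrier X \<subseteq> carrier (Pth X)"
    by (auto intro: Pth_gen_closed)
  have normal: "?K \<lhd> Pth X"
    by (rule symmetric_paths_normal[OF E Pth_generated])
  have "?S \<subseteq> ?K"
  proof clarify
    fix a b assume "(a, b) \<in> Eq_on (carrier X) f"
    then have "symmetric_to (Pth X) (Pth_map X Y f) (Pth_gen X ` carrier X) (Pth_gen X a) (Pth_gen X b)"
      by (intro symmetric_to_gen E) (auto simp: Eq_on_def Pth_map_gen[OF assms(3)])
    then show "Pth_gen X a \<otimes>\<^bsub>Pth X\<^esub> inv\<^bsub>Pth X\<^esub> Pth_gen X b \<in> ?K"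
      unfolding symmetric_paths_def by blast
  qed
  with normal have "normal_closure (Pth X) ?S \<subseteq> ?K"
    unfolding normal_closure_def by blast
  moreover have "?K \<subseteq> ?ker"
    by (rule symmetric_paths_subset_kernel)
  moreover have "?ker \<subseteq> normal_closure (Pth X) ?S"
    by (rule kernel_Pth_map_subset_normal_closure[OF assms(1,3,4)])
  ultimately show ?thesis using normal by blast
qed

end
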